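(* Let $N,N'$ be integers with $2\le N'\le N-2$. The lower triangular matrix $H\in\mathbb{R}^{(N-1)\times(N-1)}$ with nonzero diagonal entries whose Q-functions are $$Q(N-1,k,j)=\begin{cases}\frac jN\binom{N-j-1}{k-1} & \text{for } j=1,\dots,N'-1,\\[1mm] \frac{N'(N-N'+1)}{N(k+1)}\binom{N-N'-1}{k-1} & \text{for } j=N',\\[1mm] \frac1{k+1}\binom{N-j-1}{k-1} & \text{for } j=N'+1,\dots,N-1,\end{cases}\qquad k=1,\dots,N-j,$$ is given by the following blocks: - the upper left $(N'-1)\times(N'-1)$ block (rows and columns $1,\dots,N'-1$) is $H_{\mathrm{OHM}}(N'-1)$; - row $N'$ has $h_{N',j}=j\left(\frac1N-\frac1{N'}\right)$ for $j=1,\dots,N'-1$ and $h_{N',N'}=\frac{N'(N-N')}{N}$; - column $N'$ has $h_{k,N'}=(N-k)\left(\frac1N-\frac1{N-N'}\right)$ for $k=N'+1,\dots,N-1$; - the block with rows $N'+1,\dots,N-1$ and columns $1,\dots,N'-1$ is zero; - the lower right $(N-N'-1)\times(N-N'-1)$ block (rows and columns $N'+1,\dots,N-1$) is $H^{\mathsf A}_{\mathrm{OHM}}(N-N'-1)$.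
   Context: For a lower triangular $H=(h_{i,j})\in\mathbb{R}^{(N-1)\times(N-1)}$ define for $m,j\in\{1,\dots,N-1\}$ $$Q(N-1,m,j)=\sum_{j=j(1)\le i(1)<j(2)\le i(2)<\cdots<j(m)\le i(m)\le N-1}\ \prod_{r=1}^m h_{i(r),j(r)}$$ (empty sums are $0$). The map sending a lower triangular $H$ with nonzero diagonal entries to $(Q(N-1,k,j))_{1\le j\le N-1,\,1\le k\le N-j}$ is one-to-one onto the families with $Q(N-1,N-j,j)\ne0$ for all $j$. $H_{\mathrm{OHM}}(n)\in\mathbb{R}^{n\times n}$ is the lower triangular matrix with entries $(H_{\mathrm{OHM}}(n))_{k,k}=\frac{k}{k+1}$ and $(H_{\mathrm{OHM}}(n))_{k,j}=-\frac{j}{k(k+1)}$ for $j<k$. $H^{\mathsf A}_{\mathrm{OHM}}(n)$ is its anti-diagonal transpose: $(H^{\mathsf A}_{\mathrm{OHM}}(n))_{k,j}=(H_{\mathrm{OHM}}(n))_{n+1-j,\,n+1-k}$. *)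

theory Defs
  imports Complex_Main "HOL-Library.FuncSet" "Jordan_Normal_Form.Matrix"
begin

(* All indices are 1-based; the library's are 0-based.  Only meaningful for i, j >= 1. *)
definition entry :: "real mat \<Rightarrow> nat \<Rightarrow> nat \<Rightarrow> real" where
  "entry H i j = H $$ (i - 1, j - 1)"

definition lower_triangular :: "nat \<Rightarrow> real mat \<Rightarrow> bool" where
  "lower_triangular n H \<longleftrightarrow>
     H \<in> carrier_mat n n \<and> (\<forall>i\<in>{1..n}. \<forall>j\<in>{1..n}. i < j \<longrightarrow> entry H i j = 0)"

definition nonzero_diagonal :: "nat \<Rightarrow> real mat \<Rightarrow> bool" where
  "nonzero_diagonal n H \<longleftrightarrow> (\<forall>i\<in>{1..n}. entry H i i \<noteq> 0)"

(* The pairs (b, a) of sequences b(1),...,b(m) (column indices, j(r) in the usual notation) and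
   a(1),...,a(m) (row indices, i(r)) in {1..n} with
     j = b(1) <= a(1) < b(2) <= a(2) < ... < b(m) <= a(m) <= n.
   The extensional function space makes each sequence occur exactly once. *)
definition Q_chains :: "nat \<Rightarrow> nat \<Rightarrow> nat \<Rightarrow> ((nat \<Rightarrow> nat) \<times> (nat \<Rightarrow> nat)) set" where
  "Q_chains n m j =
     {(b, a). b \<in> {1..m} \<rightarrow>\<^sub>E {1..n} \<and> a \<in> {1..m} \<rightarrow>\<^sub>E {1..n} \<and> b 1 = j \<and>
        (\<forall>r\<in>{1..m}. b r \<le> a r) \<and> (\<forall>r\<in>{1..<m}. a r < b (r + 1))}"

(* Q(n,m,j) for an n x n matrix H, with 1 <= m, j <= n *)
definition Q_fun :: "real mat \<Rightarrow> nat \<Rightarrow> nat \<Rightarrow> nat \<Rightarrow> real" where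
  "Q_fun H n m j = (\<Sum>(b, a)\<in>Q_chains n m j. \<Prod>r\<in>{1..m}. entry H (a r) (b r))"

(* mat passes 0-based indices, hence the Suc *)
definition H_OHM :: "nat \<Rightarrow> real mat" where
  "H_OHM n = mat n n (\<lambda>(k0, j0). let k = Suc k0; j = Suc j0 in
     if j = k then real k / real (k + 1)
     else if j < k then - (real j / real (k * (k + 1)))
     else 0)"

definition anti_transpose :: "nat \<Rightarrow> real mat \<Rightarrow> real mat" where
  "anti_transpose n H =
     mat n n (\<lambda>(k0, j0). let k = Suc k0; j = Suc j0 in entry H (n + 1 - j) (n + 1 - k))"

definition HA_OHM :: "nat \<Rightarrow> real mat" where
  "HA_OHM n = anti_transpose n (H_OHM n)"

definition target_Q :: "nat \<Rightarrow> nat \<Rightarrow> nat \<Rightarrow> nat \<Rightarrow> real" where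
  "target_Q N N' k j =
     (if j < N' then real j / real N * real ((N - j - 1) choose (k - 1))
      else if j = N' then
        real N' * (real N - real N' + 1) / (real N * real (k + 1)) * real ((N - N' - 1) choose (k - 1))
      else 1 / real (k + 1) * real ((N - j - 1) choose (k - 1)))"

definition has_target_Q :: "nat \<Rightarrow> nat \<Rightarrow> real mat \<Rightarrow> bool" where
  "has_target_Q N N' H \<longleftrightarrow>
     lower_triangular (N - 1) H \<and> nonzero_diagonal (N - 1) H \<and>
     (\<forall>j\<in>{1..N - 1}. \<forall>k\<in>{1..N - j}. Q_fun H (N - 1) k j = target_Q N N' k j)"

end

(* Splitting off the first index pair of a chain gives
     Q(n,m+1,j) = sum over i >= j of h_ij T(m,i+1),
   where T(m,l) is the sum of Q(n,m,j') over j' >= l for m >= 1, and T(0,l) = 1.  Given the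
   Q-functions, this is a triangular linear system for each column of H, so H is unique.
   Conversely the tail sums of the target family have the closed form
     T(m,l) = (l C(N-l,m) + C(N-l,m+1)) / N  for l <= N',   T(m,l) = C(N-l,m) / (m+1)  for l > N',
   and substituting it into the recursion reduces the claim for each column to a telescoping
   sum. *)

theory Submission
  imports Defs
begin

section \<open>Chains of index pairs and the recursion on their length\<close>

lemma Q_chains_1:
  assumes "j \<in> {1..n}"
  shows "Q_chains n 1 j = (\<lambda>i. (\<lambda>r\<in>{1::nat..1}. j, \<lambda>r\<in>{1::nat..1}. i)) ` {j..n}"
proof (intro Set.set_eqI iffI)
  fix x assume "x \<in> Q_chains n 1 j"
  then obtain b a where x: "x = (b, a)"
    and b: "b \<in> {1..1} \<rightarrow>\<^sub>E {1..n}" and a: "a \<in> {1..1} \<rightarrow>\<^sub>E {1..n}"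
    and "b 1 = j" "b 1 \<le> a 1"
    by (auto simp: Q_chains_def)
  moreover have "b = (\<lambda>r\<in>{1..1}. j)" "a = (\<lambda>r\<in>{1..1}. a 1)"
    using a b \<open>b 1 = j\<close> by (auto simp: PiE_def extensional_def fun_eq_iff)
  moreover have "a 1 \<in> {1..n}"
    using PiE_mem[OF a] by simp
  ultimately show "x \<in> (\<lambda>i. (\<lambda>r\<in>{1::nat..1}. j, \<lambda>r\<in>{1::nat..1}. i)) ` {j..n}"
    by (intro image_eqI[where x = "a 1"]) auto
next
  fix x assume "x \<in> (\<lambda>i. (\<lambda>r\<in>{1::nat..1}. j, \<lambda>r\<in>{1::nat..1}. i)) ` {j..n}"
  then show "x \<in> Q_chains n 1 j"
    using assms by (auto simp: Q_chains_def split: if_splits)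
qed

lemma Q_fun_1:
  assumes "j \<in> {1..n}"
  shows "Q_fun H n 1 j = (\<Sum>i\<in>{j..n}. entry H i j)"
proof -
  have inj: "inj_on (\<lambda>i. (\<lambda>r\<in>{1::nat..1}. j, \<lambda>r\<in>{1::nat..1}. i)) {j..n}"
    by (rule inj_onI) (metis prod.inject restrict_apply' atLeastAtMost_singleton singletonI)
  show ?thesis
    unfolding Q_fun_def Q_chains_1[OF assms] by (subst sum.reindex[OF inj]) simp
qed

lemma finite_Q_chains: "finite (Q_chains n m j)"
  by (rule finite_subset[of _ "({1..m} \<rightarrow>\<^sub>E {1..n}) \<times> ({1..m} \<rightarrow>\<^sub>E {1..n})"])
    (auto simp: Q_chains_def intro!: finite_PiE finite_SigmaI)

text \<open>The restriction keeps the sequence extensional, so that prepending the head and taking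
  \<open>chain_tail\<close> are exact inverses on the function spaces used in
  \<open>Q_chains\<close>.\<close>

definition chain_cons :: "nat \<Rightarrow> nat \<Rightarrow> (nat \<Rightarrow> nat) \<Rightarrow> nat \<Rightarrow> nat" where
  "chain_cons m x f = (\<lambda>r\<in>{1..Suc m}. if r = 1 then x else f (r - 1))"

definition chain_tail :: "nat \<Rightarrow> (nat \<Rightarrow> nat) \<Rightarrow> nat \<Rightarrow> nat" where
  "chain_tail m f = (\<lambda>r\<in>{1..m}. f (Suc r))"

lemma chain_tail_cons:
  assumes "f \<in> {1..m} \<rightarrow>\<^sub>E A"
  shows "chain_tail m (chain_cons m x f) = f"
  using assms by (auto simp: chain_tail_def chain_cons_def PiE_def extensional_def fun_eq_iff)

lemma chain_cons_tail:
  assumes "f \<in> {1..Suc m} \<rightarrow>\<^sub>E A"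
  shows "chain_cons m (f 1) (chain_tail m f) = f"
  using assms by (auto simp: chain_tail_def chain_cons_def PiE_def extensional_def fun_eq_iff)

text \<open>The only new conditions are those at \<open>r = 1\<close>, namely
  \<open>j \<le> i\<close> and \<open>i < l\<close>; all others are conditions of the old chain
  shifted by one place.\<close>

lemma chain_cons_in_Q_chains:
  assumes "1 \<le> m" "j \<in> {1..n}" "i \<in> {j..n}" "l \<in> {Suc i..n}" "(b, a) \<in> Q_chains n m l"
  shows "(chain_cons m j b, chain_cons m i a) \<in> Q_chains n (Suc m) j"
proof -
  have ba: "b \<in> {1..m} \<rightarrow>\<^sub>E {1..n}" "a \<in> {1..m} \<rightarrow>\<^sub>E {1..n}" "b 1 = l"
    and le: "\<And>r. r \<in> {1..m} \<Longrightarrow> b r \<le> a r" and less: "\<And>r. r \<in> {1..<m} \<Longrightarrow> a r < b (r + 1)"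
    using assms(5) by (auto simp: Q_chains_def)
  have 1: "chain_cons m j b \<in> {1..Suc m} \<rightarrow>\<^sub>E {1..n}"
  proof (rule PiE_I)
    fix r assume r: "r \<in> {1..Suc m}"
    show "chain_cons m j b r \<in> {1..n}"
    proof (cases "r = 1")
      case False
      then have "r - 1 \<in> {1..m}" using r by auto
      with ba(1) have "b (r - 1) \<in> {1..n}" by (rule PiE_mem)
      with False r show ?thesis by (simp add: chain_cons_def)
    qed (use assms in \<open>simp add: chain_cons_def\<close>)
  qed (auto simp: chain_cons_def)
  have 2: "chain_cons m i a \<in> {1..Suc m} \<rightarrow>\<^sub>E {1..n}"
  proof (rule PiE_I)
    fix r assume r: "r \<in> {1..Suc m}"
    show "chain_cons m i a r \<in> {1..n}"
    proof (cases "r = 1")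
      case False
      then have "r - 1 \<in> {1..m}" using r by auto
      with ba(2) have "a (r - 1) \<in> {1..n}" by (rule PiE_mem)
      with False r show ?thesis by (simp add: chain_cons_def)
    qed (use assms in \<open>simp add: chain_cons_def\<close>)
  qed (auto simp: chain_cons_def)
  have 3: "chain_cons m j b r \<le> chain_cons m i a r" if "r \<in> {1..Suc m}" for r
  proof (cases "r = 1")
    case False
    then have "r - 1 \<in> {1..m}" using that by auto
    then have "b (r - 1) \<le> a (r - 1)" by (rule le)
    with False that show ?thesis by (simp add: chain_cons_def)
  qed (use assms(3) in \<open>simp add: chain_cons_def\<close>)
  have 4: "chain_cons m i a r < chain_cons m j b (r + 1)" if r: "r \<in> {1..<Suc m}" for r
  proof (cases "r = 1")
    case True
    then show ?thesis using ba(3) assms(1,4) by (simp add: chain_cons_def)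
  next
    case False
    then have "r - 1 \<in> {1..<m}" "Suc (r - 1) = r" using r by auto
    with less[of "r - 1"] have "a (r - 1) < b r" by simp
    with False r show ?thesis by (simp add: chain_cons_def)
  qed
  have "chain_cons m j b 1 = j"
    by (simp add: chain_cons_def)
  with 1 2 3 4 show ?thesis
    by (simp add: Q_chains_def)
qed

lemma chain_tail_in_Q_chains:
  assumes "1 \<le> m" "(b, a) \<in> Q_chains n (Suc m) j"
  shows "b 1 = j" "a 1 \<in> {j..n}" "b 2 \<in> {Suc (a 1)..n}"
    and "(chain_tail m b, chain_tail m a) \<in> Q_chains n m (b 2)"
proof -
  have ba: "b \<in> {1..Suc m} \<rightarrow>\<^sub>E {1..n}" "a \<in> {1..Suc m} \<rightarrow>\<^sub>E {1..n}" and b1: "b 1 = j"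
    and le: "\<And>r. r \<in> {1..Suc m} \<Longrightarrow> b r \<le> a r"
    and less: "\<And>r. r \<in> {1..<Suc m} \<Longrightarrow> a r < b (r + 1)"
    using assms(2) by (auto simp: Q_chains_def)
  show "b 1 = j" by fact
  have "a 1 \<in> {1..n}" "b 2 \<in> {1..n}"
    using PiE_mem[OF ba(2), of 1] PiE_mem[OF ba(1), of 2] assms(1) by auto
  then show "a 1 \<in> {j..n}" "b 2 \<in> {Suc (a 1)..n}"
    using le[of 1] less[of 1] b1 assms(1) by (auto simp: numeral_2_eq_2)
  have "chain_tail m b \<in> {1..m} \<rightarrow>\<^sub>E {1..n}" "chain_tail m a \<in> {1..m} \<rightarrow>\<^sub>E {1..n}"
    using PiE_mem[OF ba(1), of "Suc _"] PiE_mem[OF ba(2), of "Suc _"]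
    by (auto simp: chain_tail_def)
  moreover have "chain_tail m b r \<le> chain_tail m a r" if "r \<in> {1..m}" for r
    using that le[of "Suc r"] by (simp add: chain_tail_def)
  moreover have "chain_tail m a r < chain_tail m b (r + 1)" if "r \<in> {1..<m}" for r
    using that less[of "Suc r"] by (simp add: chain_tail_def)
  moreover have "chain_tail m b 1 = b 2"
    using assms(1) by (simp add: chain_tail_def numeral_2_eq_2)
  ultimately show "(chain_tail m b, chain_tail m a) \<in> Q_chains n m (b 2)"
    by (auto simp: Q_chains_def)
qed

text \<open>Cutting a chain after its first pair is a bijection onto triples of a row
  \<open>i\<close>, a next column \<open>l > i\<close> and a shorter chain starting at
  \<open>l\<close>; the weight of the chain factors accordingly.\<close>

lemma Q_fun_Suc:
  assumes "1 \<le> m" "j \<in> {1..n}"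
  shows "Q_fun H n (Suc m) j = (\<Sum>i\<in>{j..n}. entry H i j * (\<Sum>l\<in>{Suc i..n}. Q_fun H n m l))"
proof -
  define w where "w m = (\<lambda>(b, a). \<Prod>r\<in>{1..m}. entry H (a r) (b r))" for m :: nat
  define S where "S = (SIGMA i:{j..n}. SIGMA l:{Suc i..n}. Q_chains n m l)"
  have "Q_fun H n (Suc m) j = sum (w (Suc m)) (Q_chains n (Suc m) j)"
    by (simp add: Q_fun_def w_def)
  also have "\<dots> = (\<Sum>(i, l, x)\<in>S. entry H i j * w m x)"
  proof (rule sum.reindex_bij_witness[where
        i = "\<lambda>(i, l, b, a). (chain_cons m j b, chain_cons m i a)" and
        j = "\<lambda>(b, a). (a 1, b 2, chain_tail m b, chain_tail m a)"])
    fix x assume x: "x \<in> Q_chains n (Suc m) j"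
    obtain b a where ba: "x = (b, a)" by (cases x)
    note tail = chain_tail_in_Q_chains[OF assms(1) x[unfolded ba]]
    have ext: "b \<in> {1..Suc m} \<rightarrow>\<^sub>E {1..n}" "a \<in> {1..Suc m} \<rightarrow>\<^sub>E {1..n}"
      using x by (auto simp: ba Q_chains_def)
    show "(case case x of (b, a) \<Rightarrow> (a 1, b 2, chain_tail m b, chain_tail m a) of
        (i, l, b, a) \<Rightarrow> (chain_cons m j b, chain_cons m i a)) = x"
      using chain_cons_tail[OF ext(1)] chain_cons_tail[OF ext(2)] tail(1) by (simp add: ba)
    show "(case x of (b, a) \<Rightarrow> (a 1, b 2, chain_tail m b, chain_tail m a)) \<in> S"
      using tail by (simp add: ba S_def)
    have "w (Suc m) x = entry H (a 1) (b 1) * (\<Prod>r\<in>{Suc 1..Suc m}. entry H (a r) (b r))"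
      by (simp add: w_def ba prod.atLeast_Suc_atMost)
    also have "(\<Prod>r\<in>{Suc 1..Suc m}. entry H (a r) (b r)) = w m (chain_tail m b, chain_tail m a)"
      unfolding prod.shift_bounds_cl_Suc_ivl by (simp add: w_def chain_tail_def)
    finally show "(case case x of (b, a) \<Rightarrow> (a 1, b 2, chain_tail m b, chain_tail m a) of
        (i, l, x) \<Rightarrow> entry H i j * w m x) = w (Suc m) x"
      using tail(1) by (simp add: ba)
  next
    fix y assume y: "y \<in> S"
    obtain i l b a where yeq: "y = (i, l, b, a)" by (cases y)
    have i: "i \<in> {j..n}" "l \<in> {Suc i..n}" "(b, a) \<in> Q_chains n m l"
      using y by (auto simp: yeq S_def)
    have ext: "b \<in> {1..m} \<rightarrow>\<^sub>E {1..n}" "a \<in> {1..m} \<rightarrow>\<^sub>E {1..n}" and "b 1 = l"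
      using i(3) by (auto simp: Q_chains_def)
    \<comment> \<open>Position 2 of the longer chain is position 1 of the shorter one, so
      \<open>l\<close> can be recovered; it lies in the domain because
      \<open>1 \<le> m\<close>.\<close>
    then have "chain_cons m i a 1 = i" "chain_cons m j b 2 = l"
      using assms(1) by (auto simp: chain_cons_def)
    then show "(case case y of (i, l, b, a) \<Rightarrow> (chain_cons m j b, chain_cons m i a) of
        (b, a) \<Rightarrow> (a 1, b 2, chain_tail m b, chain_tail m a)) = y"
      using chain_tail_cons[OF ext(1)] chain_tail_cons[OF ext(2)] by (simp add: yeq)
    show "(case y of (i, l, b, a) \<Rightarrow> (chain_cons m j b, chain_cons m i a))
        \<in> Q_chains n (Suc m) j"
      using chain_cons_in_Q_chains[OF assms i] by (simp add: yeq)
  qed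
  also have "\<dots> = (\<Sum>i\<in>{j..n}. \<Sum>l\<in>{Suc i..n}. \<Sum>x\<in>Q_chains n m l. entry H i j * w m x)"
    by (simp add: S_def sum.Sigma finite_Q_chains finite_SigmaI split_def)
  also have "\<dots> = (\<Sum>i\<in>{j..n}. entry H i j * (\<Sum>l\<in>{Suc i..n}. Q_fun H n m l))"
    by (simp add: sum_distrib_left Q_fun_def w_def)
  finally show ?thesis .
qed

section \<open>Tail sums of the Q-functions and the range where they vanish\<close>

text \<open>The value 1 at \<open>m = 0\<close> is a convention that merges \<open>Q_fun_1\<close>
  and \<open>Q_fun_Suc\<close> into one recursion; an empty chain has no first index over which one
  could sum.\<close>

definition Q_tail :: "real mat \<Rightarrow> nat \<Rightarrow> nat \<Rightarrow> nat \<Rightarrow> real" where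
  "Q_tail H n m l = (if m = 0 then 1 else \<Sum>j\<in>{l..n}. Q_fun H n m j)"

lemma Q_fun_rec:
  assumes "j \<in> {1..n}"
  shows "Q_fun H n (Suc m) j = (\<Sum>i\<in>{j..n}. entry H i j * Q_tail H n m (Suc i))"
  using Q_fun_1[OF assms] Q_fun_Suc[OF _ assms]
  by (cases "m = 0") (auto simp: Q_tail_def)

text \<open>Column indices strictly increase along a chain, so a chain starting in column
  \<open>j\<close> has at most \<open>n + 1 - j\<close> pairs. The recursion turns this into an
  induction on \<open>k\<close>.\<close>

lemma Q_fun_eq_0:
  assumes "j \<in> {1..n}" "n + 1 - j < k"
  shows "Q_fun H n k j = 0"
  using assms
proof (induction k arbitrary: j)
  case (Suc k)
  have "Q_tail H n k (Suc i) = 0" if "i \<in> {j..n}" for i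
    using that Suc.prems by (auto simp: Q_tail_def intro!: sum.neutral Suc.IH)
  then show ?case
    using Q_fun_rec[OF Suc.prems(1)] by simp
qed simp

lemma Q_tail_eq_0:
  assumes "1 \<le> l" "l \<le> n + 1" "n + 1 - l < k"
  shows "Q_tail H n k l = 0"
  using assms by (auto simp: Q_tail_def intro!: sum.neutral Q_fun_eq_0)

text \<open>These are the diagonal coefficients of the triangular system: by
  \<open>Q_fun_eq_0\<close> only the first summand of the tail survives.\<close>

lemma Q_tail_diagonal:
  assumes "i \<in> {1..n}"
  shows "Q_tail H n (n - i) (Suc i) = (if i = n then 1 else Q_fun H n (n - i) (Suc i))"
proof (cases "i = n")
  case False
  then have "Q_tail H n (n - i) (Suc i)
      = Q_fun H n (n - i) (Suc i) + (\<Sum>l\<in>{Suc (Suc i)..n}. Q_fun H n (n - i) l)"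
    using assms by (simp add: Q_tail_def sum.atLeast_Suc_atMost)
  also have "(\<Sum>l\<in>{Suc (Suc i)..n}. Q_fun H n (n - i) l) = 0"
    by (intro sum.neutral ballI Q_fun_eq_0) auto
  finally show ?thesis using False by simp
qed (simp add: Q_tail_def)

section \<open>Uniqueness of a matrix with given Q-functions\<close>

text \<open>For fixed \<open>j\<close> the recursion is a linear system for column \<open>j\<close> whose coefficients depend on
  the Q-functions only; it is triangular because \<open>Q(n,k,l)\<close> vanishes for \<open>k > n + 1 - l\<close>.\<close>

lemma Q_fun_injective:
  assumes H: "lower_triangular n H" and H': "lower_triangular n H'"
    and eq: "\<And>j k. j \<in> {1..n} \<Longrightarrow> k \<in> {1..n + 1 - j} \<Longrightarrow> Q_fun H n k j = Q_fun H' n k j"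
    and nz: "\<And>j. j \<in> {1..n} \<Longrightarrow> Q_fun H n (n + 1 - j) j \<noteq> 0"
  shows "H = H'"
proof -
  \<comment> \<open>Beyond \<open>n + 1 - j\<close> both sides vanish, so the agreement extends to
    every \<open>k \<ge> 1\<close>.\<close>
  have Q_eq: "Q_fun H n k j = Q_fun H' n k j" if "j \<in> {1..n}" "1 \<le> k" for j k
    using eq[of j k] Q_fun_eq_0[of j n k] that by (cases "k \<le> n + 1 - j") auto
  have tail_eq: "Q_tail H n k (Suc i) = Q_tail H' n k (Suc i)" for k i
    by (auto simp: Q_tail_def intro!: sum.cong Q_eq)
  have col: "entry H i j = entry H' i j" if "j \<in> {1..n}" "i \<in> {j..n}" for i j
    using that(2)
  proof (induction i rule: less_induct)
    case (less i)
    define d where "d s = entry H s j - entry H' s j" for s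
    define T where "T s = Q_tail H n (n - i) (Suc s)" for s
    \<comment> \<open>Chain length \<open>Suc (n - i)\<close> isolates row \<open>i\<close>: rows
      above it drop out by the induction hypothesis, and for rows \<open>s > i\<close> the
      coefficient \<open>T s\<close> vanishes since \<open>n - s < n - i\<close>.\<close>
    have "(\<Sum>s\<in>{j..n}. d s * T s)
        = Q_fun H n (Suc (n - i)) j - Q_fun H' n (Suc (n - i)) j"
      unfolding Q_fun_rec[OF that(1)] d_def T_def
      by (simp add: left_diff_distrib sum_subtractf tail_eq)
    also have "\<dots> = 0"
      using Q_eq[OF that(1)] by simp
    finally have "0 = (\<Sum>s\<in>{j..n}. d s * T s)" by simp
    also have "\<dots> = (\<Sum>s\<in>{i}. d s * T s)"
    proof (rule sum.mono_neutral_right)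
      show "\<forall>s\<in>{j..n} - {i}. d s * T s = 0"
      proof
        fix s assume s: "s \<in> {j..n} - {i}"
        show "d s * T s = 0"
        proof (cases "s < i")
          case True
          then show ?thesis using less.IH[of s] s by (simp add: d_def)
        next
          case False
          then show ?thesis using s less.prems that(1)
            by (auto simp: T_def intro!: Q_tail_eq_0)
        qed
      qed
    qed (use less.prems in auto)
    finally have "d i * T i = 0" by simp
    moreover have "T i \<noteq> 0"
      unfolding T_def using nz[of "Suc i"] less.prems that(1) by (subst Q_tail_diagonal) auto
    ultimately show ?case by (simp add: d_def)
  qed
  have "H $$ (r, c) = H' $$ (r, c)" if "r < n" "c < n" for r c
  proof (cases "r < c")
    case True
    have "entry H (Suc r) (Suc c) = 0" "entry H' (Suc r) (Suc c) = 0"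
      using H H' that True by (auto simp: lower_triangular_def)
    then show ?thesis by (simp add: entry_def)
  next
    case False
    then show ?thesis using col[of "Suc c" "Suc r"] that by (simp add: entry_def)
  qed
  then show ?thesis
    using H H' by (intro eq_matI) (auto simp: lower_triangular_def)
qed

section \<open>A criterion for computing Q-functions, and binomial identities\<close>

lemma sum_diff_Suc_atLeastAtMost:
  fixes f :: "nat \<Rightarrow> 'a::ab_group_add"
  assumes "l \<le> Suc n"
  shows "(\<Sum>i\<in>{l..n}. f i - f (Suc i)) = f l - f (Suc n)"
  using sum_Suc_diff[OF assms, of "\<lambda>i. - f i"] by simp

text \<open>A guessed family \<open>T\<close> that satisfies the recursion must be the family of
  tail sums: by induction on \<open>m\<close>, the differences of \<open>T\<close> telescope, and
  \<open>T_last\<close> removes the end term.\<close>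

lemma Q_fun_eqI:
  assumes T0: "\<And>l. T 0 l = 1" and T_last: "\<And>m. T (Suc m) (Suc n) = 0"
    and step: "\<And>j m. j \<in> {1..n} \<Longrightarrow>
      (\<Sum>i\<in>{j..n}. entry H i j * T m (Suc i)) = T (Suc m) j - T (Suc m) (Suc j)"
    and "j \<in> {1..n}"
  shows "Q_fun H n (Suc m) j = T (Suc m) j - T (Suc m) (Suc j)"
  using assms(4)
proof (induction m arbitrary: j)
  case 0
  then show ?case using Q_fun_rec[OF 0] step[OF 0, of 0] by (simp add: Q_tail_def T0)
next
  case (Suc m)
  have "Q_tail H n (Suc m) (Suc i) = T (Suc m) (Suc i)" if "i \<in> {j..n}" for i
  proof -
    have "Q_tail H n (Suc m) (Suc i) = (\<Sum>l\<in>{Suc i..n}. T (Suc m) l - T (Suc m) (Suc l))"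
      by (auto simp: Q_tail_def intro!: sum.cong Suc.IH)
    also have "\<dots> = T (Suc m) (Suc i)"
      using that by (simp add: sum_diff_Suc_atLeastAtMost T_last)
    finally show ?thesis .
  qed
  then have "Q_fun H n (Suc (Suc m)) j = (\<Sum>i\<in>{j..n}. entry H i j * T (Suc m) (Suc i))"
    unfolding Q_fun_rec[OF Suc.prems] by (intro sum.cong) auto
  then show ?case
    by (simp only: step[OF Suc.prems])
qed

lemma binomial_absorb_real:
  assumes "1 \<le> p"
  shows "real p * real ((p - 1) choose m) = real (m + 1) * real (p choose (m + 1))"
  using Suc_times_binomial_eq[of "p - 1" m] assms
  by (metis Suc_eq_plus1 le_add_diff_inverse2 mult.commute of_nat_mult)

text \<open>Absorption combined with Pascal's rule. The subtraction is real, so \<open>p < m\<close>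
  is covered too: both binomials are then 0.\<close>

lemma binomial_Suc_real:
  "real (m + 1) * real (p choose (m + 1)) = (real p - real m) * real (p choose m)"
proof -
  have "real (Suc p) * real (p choose m) = real (Suc m) * real (Suc p choose Suc m)"
    using binomial_absorb_real[of "Suc p" m] by simp
  then show ?thesis by (simp add: algebra_simps)
qed

lemma binomial_pascal_real:
  assumes "1 \<le> p"
  shows "real (p choose (m + 1)) = real ((p - 1) choose m) + real ((p - 1) choose (m + 1))"
  using assms by (cases p) auto

text \<open>Absorption turns each summand into \<open>(N - i) choose (m + 1)\<close>, which leaves a
  hockey-stick sum. It evaluates the part of a column below the diagonal, for columns from
  \<open>N'\<close> on.\<close>

lemma sum_weighted_binomial:
  assumes "j < N"
  shows "(\<Sum>i\<in>{Suc j..N - 1}. (real N - real i) * (real ((N - Suc i) choose m) / real (m + 1)))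
    = real ((N - j) choose (m + 2))"
proof -
  have "(\<Sum>i\<in>{Suc j..N - 1}. (real N - real i) * (real ((N - Suc i) choose m) / real (m + 1)))
    = (\<Sum>i\<in>{Suc j..N - 1}.
        real ((N + 1 - i) choose (m + 2)) - real ((N + 1 - Suc i) choose (m + 2)))"
  proof (rule sum.cong[OF refl])
    fix i assume i: "i \<in> {Suc j..N - 1}"
    then have "1 \<le> N - i" using assms by auto
    have "(real N - real i) * real ((N - Suc i) choose m) = real (m + 1) * real ((N - i) choose (m + 1))"
      using binomial_absorb_real[of "N - i" m] i \<open>1 \<le> N - i\<close> by (simp add: of_nat_diff)
    then have "(real N - real i) * (real ((N - Suc i) choose m) / real (m + 1))
        = real ((N - i) choose (m + 1))"
      by (simp add: field_simps)
    also have "\<dots> = real ((N + 1 - i) choose (m + 2)) - real ((N + 1 - Suc i) choose (m + 2))"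
    proof -
      have "N + 1 - i = Suc (N - i)" "N + 1 - Suc i = N - i" using i by auto
      then show ?thesis by simp
    qed
    finally show "(real N - real i) * (real ((N - Suc i) choose m) / real (m + 1)) = \<dots>" .
  qed
  also have "\<dots> = real ((N - j) choose (m + 2))"
    \<comment> \<open>The end term of the telescoping sum is \<open>1 choose (m + 2)\<close>, which
      is 0.\<close>
    using assms by (subst sum_diff_Suc_atLeastAtMost) auto
  finally show ?thesis .
qed

text \<open>The left side is what diagonal and lower entries of an anti-transposed OHM column
  contribute, up to a factor. After clearing denominators both sides are
  \<open>(p + 1) * (m + 1)\<close> times \<open>p choose (m + 1)\<close>.\<close>

lemma anti_OHM_column_identity:
  assumes "1 \<le> p"
  shows "real (p choose (m + 1)) - real (p choose (m + 2)) / real p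
    = (real p + 1) * real ((p - 1) choose m) / real (m + 2)"
proof -
  define A B C where "A = real (p choose (m + 1))" and "B = real (p choose (m + 2))"
    and "C = real ((p - 1) choose m)"
  have 1: "real p * C = (real m + 1) * A"
    using binomial_absorb_real[OF assms, of m] by (simp add: A_def C_def)
  have 2: "(real m + 2) * B = (real p - real m - 1) * A"
    using binomial_Suc_real[of "m + 1" p] by (simp add: A_def B_def algebra_simps)
  have "(real p * A - B) * (real m + 2) = (real p + 1) * (real p * C)"
    unfolding 1 using 2 by (simp add: algebra_simps)
  then have "A - B / real p = (real p + 1) * C / (real m + 2)"
    using assms by (simp add: field_simps)
  then show ?thesis by (simp add: A_def B_def C_def)
qed

section \<open>The target family as differences of closed-form tail sums\<close>

text \<open>The tail sums \<open>\<Sum>\<^sub>j\<^sub>\<ge>\<^sub>l Q(N-1,m,j)\<close> of the target family, in closed form.\<close>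

definition target_tail :: "nat \<Rightarrow> nat \<Rightarrow> nat \<Rightarrow> nat \<Rightarrow> real" where
  "target_tail N N' m l =
     (if m = 0 then 1
      else if l \<le> N' then (real l * real ((N - l) choose m) + real ((N - l) choose (m + 1))) / real N
      else real ((N - l) choose m) / real (m + 1))"

text \<open>The formula also gives 1 at \<open>m = 0\<close>, because
  \<open>l + (N - l) = N\<close>; hence the column computations need no case split on
  \<open>m\<close>.\<close>

lemma target_tail_low:
  assumes "l \<le> N'" "l \<le> N" "0 < N"
  shows "target_tail N N' m l
    = (real l * real ((N - l) choose m) + real ((N - l) choose (m + 1))) / real N"
  using assms by (simp add: target_tail_def of_nat_diff)

lemma target_tail_high:
  assumes "N' < l"
  shows "target_tail N N' m l = real ((N - l) choose m) / real (m + 1)"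
  using assms by (simp add: target_tail_def)

text \<open>Away from \<open>N'\<close> this is Pascal's rule. At \<open>j = N'\<close> the two
  closed forms meet, and their mismatch produces the special factor
  \<open>N - N' + 1\<close>.\<close>

lemma target_tail_diff:
  assumes "2 \<le> N'" "N' \<le> N - 2" "j \<in> {1..N - 1}"
  shows "target_tail N N' (Suc m) j - target_tail N N' (Suc m) (Suc j) = target_Q N N' (Suc m) j"
proof -
  have N: "0 < N" and p: "1 \<le> N - j" using assms by auto
  have pascal: "real ((N - j) choose (m + 1))
      = real ((N - Suc j) choose m) + real ((N - Suc j) choose (m + 1))" for m
    using binomial_pascal_real[OF p, of m] by simp
  consider "j < N'" | "j = N'" | "N' < j" by linarith
  then show ?thesis
  proof cases
    case 1
    then show ?thesis
      using N assms pascal[of m] pascal[of "m + 1"]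
      by (simp add: target_tail_low target_Q_def field_simps)
  next
    case 2
    define M where "M = N - N'"
    have M: "1 \<le> M" "real N = real M + real N'" and j: "N - j = M" "N - Suc j = M - 1"
      using assms 2 by (auto simp: M_def of_nat_diff)
    define A B C D where "A = real (M choose (m + 1))" and "B = real (M choose (m + 2))"
      and "C = real ((M - 1) choose m)" and "D = real ((M - 1) choose (m + 1))"
    have e1: "real M * C = (real m + 1) * A"
      using binomial_absorb_real[OF M(1), of m] by (simp add: A_def C_def)
    have e2: "(real m + 2) * B = (real M - real m - 1) * A"
      using binomial_Suc_real[of "m + 1" M] by (simp add: A_def B_def algebra_simps)
    have e3: "A = C + D"
      using binomial_pascal_real[OF M(1), of m] by (simp add: A_def C_def D_def)
    have "(real m + 2) * B = real M * A - (real m + 1) * A"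
      using e2 by (simp add: algebra_simps)
    also have "\<dots> = real M * D"
      unfolding e1[symmetric] by (simp add: e3 algebra_simps)
    finally have D: "(real m + 2) * B = real M * D" .
    have A: "(real m + 2) * A = (real M + 1) * C + D"
      using e1 e3 by (simp add: algebra_simps)
    \<comment> \<open>In terms of \<open>C\<close> and \<open>D\<close>, the weights
      \<open>N'\<close> and \<open>M\<close> of \<open>D\<close> add up to \<open>N\<close>; this
      term cancels against the tail at \<open>Suc N'\<close>.\<close>
    have "(real N' * A + B) * (real m + 2) = real N' * ((real m + 2) * A) + (real m + 2) * B"
      by (simp add: algebra_simps)
    also have "\<dots> = real N' * (real M + 1) * C + real N * D"
      unfolding A D M(2) by (simp add: algebra_simps)
    finally have "(real N' * A + B) / real N - D / (real m + 2)
        = real N' * (real M + 1) / (real N * (real m + 2)) * C"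
      using N by (simp add: field_simps)
    moreover have "target_tail N N' (Suc m) j = (real N' * A + B) / real N"
      using 2 N assms j by (simp add: target_tail_low A_def B_def)
    moreover have "target_tail N N' (Suc m) (Suc j) = D / (real m + 2)"
      using 2 j by (simp add: target_tail_high D_def add.commute)
    moreover have "target_Q N N' (Suc m) j
        = real N' * (real M + 1) / (real N * (real m + 2)) * C"
      using 2 j M(2) by (simp add: target_Q_def C_def add_ac)
    ultimately show ?thesis by simp
  next
    case 3
    then show ?thesis
      using N assms pascal[of m] by (simp add: target_tail_high target_Q_def diff_divide_distrib[symmetric])
  qed
qed

section \<open>The explicit block matrix and its column sums\<close>

text \<open>In the last branch, reflecting an index inside the lower right block sends the global
  index \<open>k\<close> to \<open>N - k\<close>. The formula is thus that of \<open>H_OHM\<close>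
  at row \<open>N - j\<close> and column \<open>N - k\<close>.\<close>

definition block_entry :: "nat \<Rightarrow> nat \<Rightarrow> nat \<Rightarrow> nat \<Rightarrow> real" where
  "block_entry N N' k j =
     (if k < j then 0
      else if j < N' then
        (if k = j then real j / (real j + 1)
         else if k < N' then - (real j / (real k * (real k + 1)))
         else if k = N' then real j * (1 / real N - 1 / real N')
         else 0)
      else if j = N' then
        (if k = N' then real N' * (real N - real N') / real N
         else (real N - real k) * (1 / real N - 1 / (real N - real N')))
      else
        (if k = j then (real N - real j) / (real N - real j + 1)
         else - ((real N - real k) / ((real N - real j) * (real N - real j + 1)))))"

definition block_mat :: "nat \<Rightarrow> nat \<Rightarrow> real mat" where
  "block_mat N N' = mat (N - 1) (N - 1) (\<lambda>(k, j). block_entry N N' (Suc k) (Suc j))"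

lemma entry_H_OHM:
  assumes "k \<in> {1..n}" "j \<in> {1..n}"
  shows "entry (H_OHM n) k j =
    (if j = k then real k / (real k + 1)
     else if j < k then - (real j / (real k * (real k + 1)))
     else 0)"
proof -
  obtain k' j' where "k = Suc k'" "j = Suc j'"
    using assms by (cases k; cases j) auto
  then show ?thesis
    using assms by (simp add: entry_def H_OHM_def add.commute) (simp add: algebra_simps)
qed

lemma entry_block_mat:
  assumes "k \<in> {1..N - 1}" "j \<in> {1..N - 1}"
  shows "entry (block_mat N N') k j = block_entry N N' k j"
  using assms by (cases k; cases j) (auto simp: entry_def block_mat_def)

text \<open>Column \<open>N'\<close> is \<open>N' * (N - N' + 1) / N\<close> times the column that
  the anti-transposed OHM pattern would have at \<open>j = N'\<close>. One computation with the
  factor \<open>c\<close> therefore covers all these columns.\<close>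

lemma block_entry_column_high:
  assumes "2 \<le> N'" "N' \<le> N - 2" "j \<in> {1..N - 1}" "N' \<le> j"
  shows "(\<Sum>i\<in>{j..N - 1}. block_entry N N' i j * target_tail N N' m (Suc i))
    = target_Q N N' (Suc m) j"
proof -
  define p where "p = N - j"
  define c where "c = (if j = N' then real N' * (real p + 1) / real N else 1)"
  \<comment> \<open>Every entry of the column contains the factor \<open>N - i\<close>, on the
    diagonal as \<open>p\<close>; it is absorbed into the tail.\<close>
  define f where "f i = (real N - real i) * (real ((N - Suc i) choose m) / real (m + 1))" for i
  have p: "1 \<le> p" "real p = real N - real j" and N: "0 < N" and j: "j < N"
    using assms by (auto simp: p_def of_nat_diff)
  have tail: "target_tail N N' m (Suc i) = real ((N - Suc i) choose m) / real (m + 1)"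
    if "j \<le> i" for i
    using that assms by (intro target_tail_high) auto
  have diag: "block_entry N N' j j * target_tail N N' m (Suc j)
      = c / (real p + 1) * f j"
    using assms p N by (auto simp: tail f_def block_entry_def c_def)
  have off: "block_entry N N' i j * target_tail N N' m (Suc i)
      = - (c / (real p * (real p + 1))) * f i" if "i \<in> {Suc j..N - 1}" for i
  proof -
    have "block_entry N N' i j = - (c / (real p * (real p + 1))) * (real N - real i)"
    proof (cases "j = N'")
      case True
      have "1 / real N - 1 / real p = (real p - real N) / (real p * real N)"
        using p(1) N by (simp add: field_simps)
      also have "\<dots> = - (real N' / (real p * real N))"
        using True p(2) by simp
      finally have "1 / real N - 1 / real p = - (real N' / (real p * real N))" .
      then show ?thesis
        using True that p by (simp add: block_entry_def c_def mult_ac)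
    next
      case False
      then show ?thesis
        using that assms p by (simp add: block_entry_def c_def)
    qed
    then show ?thesis using that by (simp add: tail f_def)
  qed
  have fj: "f j = real (p choose (m + 1))"
    using binomial_absorb_real[OF p(1), of m] p(2) by (simp add: f_def p_def field_simps)
  have "(\<Sum>i\<in>{j..N - 1}. block_entry N N' i j * target_tail N N' m (Suc i))
      = c / (real p + 1) * f j + (\<Sum>i\<in>{Suc j..N - 1}. - (c / (real p * (real p + 1))) * f i)"
    using assms diag off by (simp add: sum.atLeast_Suc_atMost)
  also have "(\<Sum>i\<in>{Suc j..N - 1}. - (c / (real p * (real p + 1))) * f i)
      = - (c / (real p * (real p + 1))) * real (p choose (m + 2))"
    unfolding sum_distrib_left[symmetric] f_def sum_weighted_binomial[OF j] p_def ..
  also have "c / (real p + 1) * f j + - (c / (real p * (real p + 1))) * real (p choose (m + 2))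
      = c / (real p + 1) * (real (p choose (m + 1)) - real (p choose (m + 2)) / real p)"
    by (simp add: fj right_diff_distrib mult_ac)
  also have "\<dots> = c / (real p + 1) * ((real p + 1) * real ((p - 1) choose m) / real (m + 2))"
    unfolding anti_OHM_column_identity[OF p(1)] ..
  also have "\<dots> = c * real ((p - 1) choose m) / real (m + 2)"
  proof -
    have "c / q * (q * x / r) = c * x / r" if "q \<noteq> 0" for q r x :: real
      using that by simp
    moreover have "real p + 1 \<noteq> 0" by simp
    ultimately show ?thesis .
  qed
  also have "\<dots> = target_Q N N' (Suc m) j"
    using assms p(2) by (auto simp: target_Q_def c_def p_def)
  finally show ?thesis .
qed

text \<open>The rows between \<open>j\<close> and \<open>N'\<close> telescope. The boundary terms
  cancel against the diagonal and row \<open>N'\<close>, leaving only \<open>j / N\<close> times a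
  binomial.\<close>

lemma block_entry_column_low:
  assumes "2 \<le> N'" "N' \<le> N - 2" "j \<in> {1..N - 1}" "j < N'"
  shows "(\<Sum>i\<in>{j..N - 1}. block_entry N N' i j * target_tail N N' m (Suc i))
    = target_Q N N' (Suc m) j"
proof -
  define T where "T = target_tail N N' m"
  \<comment> \<open>\<open>U\<close> is chosen so that \<open>U i - U (Suc i)\<close> equals
    \<open>T (Suc i) / (i * (i + 1))\<close> for \<open>i\<close> strictly between \<open>j\<close>
    and \<open>N'\<close>.\<close>
  define U where "U i = real ((N - i) choose (m + 1)) / (real N * real i)" for i
  have N: "0 < N" and j: "0 < j" using assms by auto
  have T: "T (Suc i) = (real (Suc i) * real ((N - Suc i) choose m)
      + real ((N - Suc i) choose (m + 1))) / real N" if "i < N'" for i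
    unfolding T_def using that assms by (intro target_tail_low) auto
  have diag: "block_entry N N' j j * T (Suc j)
      = real j * (real ((N - Suc j) choose m) / real N + U (Suc j))"
    using assms N by (simp add: block_entry_def T U_def divide_simps) (simp add: algebra_simps)
  have mid: "block_entry N N' i j * T (Suc i) = - real j * (U i - U (Suc i))"
    if i: "i \<in> {Suc j..N' - 1}" for i
  proof -
    have pascal: "real ((N - i) choose (m + 1))
        = real ((N - Suc i) choose m) + real ((N - Suc i) choose (m + 1))"
    proof -
      have "N - i = Suc (N - Suc i)" using i assms by auto
      then show ?thesis by simp
    qed
    have "block_entry N N' i j = - (real j / (real i * (real i + 1)))"
      using i assms by (auto simp: block_entry_def)
    moreover have "T (Suc i) / (real i * (real i + 1)) = U i - U (Suc i)"
    proof -
      have "0 < i" "i < N'" using i j assms by auto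
      then show ?thesis
        unfolding T[OF \<open>i < N'\<close>] U_def pascal using N by (simp add: divide_simps) (simp add: algebra_simps)
    qed
    ultimately show ?thesis by (metis minus_mult_left times_divide_eq_left times_divide_eq_right)
  qed
  \<comment> \<open>Here \<open>Suc N'\<close> already falls under the other closed form of the
    tail; the entry in row \<open>N'\<close> is exactly what closes the telescoping sum.\<close>
  have row: "block_entry N N' N' j * T (Suc N') = - real j * U N'"
  proof -
    have abs: "(real N - real N') * real ((N - Suc N') choose m)
        = real ((N - N') choose (m + 1)) * (real m + 1)"
      using binomial_absorb_real[of "N - N'" m] assms by (simp add: of_nat_diff mult.commute)
    have "1 / real N - 1 / real N' = - ((real N - real N') / (real N * real N'))"
      using N assms by (simp add: field_simps)
    then have "block_entry N N' N' j * T (Suc N') = - real j *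
        ((real N - real N') * real ((N - Suc N') choose m) / (real N * real N' * (real m + 1)))"
      using assms by (simp add: block_entry_def T_def target_tail_high add.commute)
    also have "\<dots> = - real j * U N'"
    proof -
      have "real m + 1 \<noteq> 0" by simp
      then show ?thesis
        unfolding abs U_def by (subst nonzero_mult_divide_mult_cancel_right) auto
    qed
    finally show ?thesis .
  qed
  have "(\<Sum>i\<in>{j..N - 1}. block_entry N N' i j * T (Suc i))
      = (\<Sum>i\<in>{j..N'}. block_entry N N' i j * T (Suc i))"
    using assms by (intro sum.mono_neutral_right) (auto simp: block_entry_def)
  also have "\<dots> = (\<Sum>i\<in>{j..N' - 1}. block_entry N N' i j * T (Suc i))
      + block_entry N N' N' j * T (Suc N')"
    using assms by (cases N') auto
  also have "(\<Sum>i\<in>{j..N' - 1}. block_entry N N' i j * T (Suc i))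
      = block_entry N N' j j * T (Suc j)
        + (\<Sum>i\<in>{Suc j..N' - 1}. block_entry N N' i j * T (Suc i))"
    using assms by (subst sum.atLeast_Suc_atMost) auto
  also have "(\<Sum>i\<in>{Suc j..N' - 1}. block_entry N N' i j * T (Suc i))
      = - real j * (\<Sum>i\<in>{Suc j..N' - 1}. U i - U (Suc i))"
    unfolding sum_distrib_left by (rule sum.cong[OF refl]) (rule mid)
  also have "(\<Sum>i\<in>{Suc j..N' - 1}. U i - U (Suc i)) = U (Suc j) - U N'"
    using assms by (subst sum_diff_Suc_atLeastAtMost) auto
  finally have "(\<Sum>i\<in>{j..N - 1}. block_entry N N' i j * T (Suc i))
      = real j * (real ((N - Suc j) choose m) / real N)"
    unfolding diag row by (simp add: algebra_simps)
  also have "\<dots> = target_Q N N' (Suc m) j"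
    using assms by (simp add: target_Q_def)
  finally show ?thesis by (simp add: T_def)
qed

section \<open>Existence, uniqueness and the block form\<close>

lemma Q_fun_block_mat:
  assumes "2 \<le> N'" "N' \<le> N - 2" "j \<in> {1..N - 1}"
  shows "Q_fun (block_mat N N') (N - 1) (Suc m) j = target_Q N N' (Suc m) j"
proof -
  have "Q_fun (block_mat N N') (N - 1) (Suc m) j
      = target_tail N N' (Suc m) j - target_tail N N' (Suc m) (Suc j)"
  proof (rule Q_fun_eqI)
    show "target_tail N N' 0 l = 1" for l
      by (simp add: target_tail_def)
    \<comment> \<open>Since \<open>N > N'\<close>, the closed form contains
      \<open>0 choose Suc m\<close>, which is 0.\<close>
    show "target_tail N N' (Suc m) (Suc (N - 1)) = 0" for m
      using assms by (simp add: target_tail_def)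
    fix j m assume j: "j \<in> {1..N - 1}"
    have "(\<Sum>i\<in>{j..N - 1}. entry (block_mat N N') i j * target_tail N N' m (Suc i))
        = (\<Sum>i\<in>{j..N - 1}. block_entry N N' i j * target_tail N N' m (Suc i))"
      using j by (intro sum.cong refl) (auto simp: entry_block_mat)
    also have "\<dots> = target_Q N N' (Suc m) j"
      using block_entry_column_low[OF assms(1,2) j] block_entry_column_high[OF assms(1,2) j]
      by (cases "j < N'") auto
    finally show "(\<Sum>i\<in>{j..N - 1}. entry (block_mat N N') i j * target_tail N N' m (Suc i))
        = target_tail N N' (Suc m) j - target_tail N N' (Suc m) (Suc j)"
      using target_tail_diff[OF assms(1,2) j] by simp
  qed fact
  then show ?thesis using target_tail_diff[OF assms] by simp
qed

lemma has_target_Q_block_mat: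
  assumes "2 \<le> N'" "N' \<le> N - 2"
  shows "has_target_Q N N' (block_mat N N')"
proof -
  have "lower_triangular (N - 1) (block_mat N N')"
    by (auto simp: lower_triangular_def entry_block_mat)
      (auto simp: block_mat_def block_entry_def)
  moreover have "block_entry N N' i i \<noteq> 0" if "i \<in> {1..N - 1}" for i
    using that assms by (auto simp: block_entry_def)
  then have "nonzero_diagonal (N - 1) (block_mat N N')"
    by (simp add: nonzero_diagonal_def entry_block_mat)
  moreover have "Q_fun (block_mat N N') (N - 1) k j = target_Q N N' k j"
    if "j \<in> {1..N - 1}" "k \<in> {1..N - j}" for j k
    using Q_fun_block_mat[OF assms that(1), of "k - 1"] that(2) by simp
  ultimately show ?thesis by (simp add: has_target_Q_def)
qed

lemma has_target_Q_unique:
  assumes "2 \<le> N'" "N' \<le> N - 2" "has_target_Q N N' H" "has_target_Q N N' H'"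
  shows "H = H'"
proof (rule Q_fun_injective)
  fix j assume j: "j \<in> {1..N - 1}"
  \<comment> \<open>At \<open>k = N - j\<close> the binomial is 1 and the prefactor is nonzero in
    each of the three cases.\<close>
  have "target_Q N N' (N - j) j \<noteq> 0"
    using assms(1,2) j by (auto simp: target_Q_def)
  then show "Q_fun H (N - 1) (N - 1 + 1 - j) j \<noteq> 0"
    using assms j by (auto simp: has_target_Q_def)
qed (use assms in \<open>auto simp: has_target_Q_def\<close>)

theorem proposition7:
  fixes N N' :: nat
  assumes "2 \<le> N'" and "N' \<le> N - 2"
  shows "(\<exists>!H. has_target_Q N N' H) \<and>
    (\<forall>H. has_target_Q N N' H \<longrightarrow>
      (\<forall>k\<in>{1..N' - 1}. \<forall>j\<in>{1..N' - 1}. entry H k j = entry (H_OHM (N' - 1)) k j) \<and>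
      (\<forall>j\<in>{1..N' - 1}. entry H N' j = real j * (1 / real N - 1 / real N')) \<and>
      entry H N' N' = real N' * (real N - real N') / real N \<and>
      (\<forall>k\<in>{N' + 1..N - 1}.
         entry H k N' = (real N - real k) * (1 / real N - 1 / (real N - real N'))) \<and>
      (\<forall>k\<in>{N' + 1..N - 1}. \<forall>j\<in>{1..N' - 1}. entry H k j = 0) \<and>
      (\<forall>k\<in>{1..N - N' - 1}. \<forall>j\<in>{1..N - N' - 1}.
         entry H (N' + k) (N' + j) = entry (HA_OHM (N - N' - 1)) k j))"
proof -
  \<comment> \<open>Every solution is \<open>block_mat N N'\<close>, so the claims about blocks
    reduce to evaluating \<open>block_entry\<close>.\<close>
  have uniq: "H = block_mat N N'" if "has_target_Q N N' H" for H
    using has_target_Q_unique[OF assms that has_target_Q_block_mat[OF assms]] .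
  show ?thesis
  proof (intro conjI allI impI)
    show "\<exists>!H. has_target_Q N N' H"
      using has_target_Q_block_mat[OF assms] uniq by blast
  next
    fix H assume "has_target_Q N N' H"
    then have H: "H = block_mat N N'" by (rule uniq)
    have entry_H: "entry H k j = block_entry N N' k j"
      if "k \<in> {1..N - 1}" "j \<in> {1..N - 1}" for k j
      unfolding H using that by (rule entry_block_mat)
    show "\<forall>k\<in>{1..N' - 1}. \<forall>j\<in>{1..N' - 1}. entry H k j = entry (H_OHM (N' - 1)) k j"
    proof (intro ballI)
      fix k j assume kj: "k \<in> {1..N' - 1}" "j \<in> {1..N' - 1}"
      have "entry (block_mat N N') k j = block_entry N N' k j"
        using kj assms by (intro entry_block_mat) auto
      also have "\<dots> = entry (H_OHM (N' - 1)) k j"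
        using kj unfolding entry_H_OHM[OF kj] by (auto simp: block_entry_def)
      finally show "entry H k j = entry (H_OHM (N' - 1)) k j"
        by (simp add: H)
    qed
    show "\<forall>j\<in>{1..N' - 1}. entry H N' j = real j * (1 / real N - 1 / real N')"
      using assms by (auto simp: entry_H block_entry_def)
    show "entry H N' N' = real N' * (real N - real N') / real N"
      using assms by (simp add: entry_H block_entry_def)
    show "\<forall>k\<in>{N' + 1..N - 1}.
        entry H k N' = (real N - real k) * (1 / real N - 1 / (real N - real N'))"
      using assms by (auto simp: entry_H block_entry_def)
    show "\<forall>k\<in>{N' + 1..N - 1}. \<forall>j\<in>{1..N' - 1}. entry H k j = 0"
      using assms by (auto simp: entry_H block_entry_def)
    show "\<forall>k\<in>{1..N - N' - 1}. \<forall>j\<in>{1..N - N' - 1}.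
        entry H (N' + k) (N' + j) = entry (HA_OHM (N - N' - 1)) k j"
    proof (intro ballI)
      fix k j assume kj: "k \<in> {1..N - N' - 1}" "j \<in> {1..N - N' - 1}"
      define n where "n = N - N' - 1"
      have n: "k \<in> {1..n}" "j \<in> {1..n}" "N = N' + n + 1"
        using kj assms by (auto simp: n_def)
      have HA: "entry (HA_OHM n) k j = entry (H_OHM n) (n + 1 - j) (n + 1 - k)"
        using n by (cases k; cases j) (auto simp: HA_OHM_def anti_transpose_def entry_def)
      have "entry (block_mat N N') (N' + k) (N' + j) = block_entry N N' (N' + k) (N' + j)"
        using n by (intro entry_block_mat) auto
      also have "\<dots> = entry (HA_OHM n) k j"
      proof -
        \<comment> \<open>The reflected indices match because
          \<open>n + 1 - j = N - (N' + j)\<close>, and likewise for \<open>k\<close>.\<close>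
        have "n + 1 - j \<in> {1..n}" "n + 1 - k \<in> {1..n}" using n by auto
        then show ?thesis
          unfolding HA entry_H_OHM[OF \<open>n + 1 - j \<in> {1..n}\<close> \<open>n + 1 - k \<in> {1..n}\<close>]
          using n by (auto simp: block_entry_def of_nat_diff add_diff_eq)
      qed
      finally show "entry H (N' + k) (N' + j) = entry (HA_OHM (N - N' - 1)) k j"
        by (simp add: H n_def)
    qed
  qed
qed

end
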